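(* Let $k \ge 1$ be an integer and let $G$ be a finite simple graph. Then $G$ has a fractional $[1, k+\frac{1}{2}]$-factor $h$ with values in $\{0, \frac{1}{2}, 1\}$ if and only if \[ \mathit{iso}(G-S) \le \Big(k+\tfrac{1}{2}\Big)|S| \quad \text{for all } S \subseteq V(G). \]
   Context: For a graph $H$, $\mathit{iso}(H)$ denotes the number of isolated vertices of $H$. For a vertex $v$, $E_G(v)$ is the set of edges of $G$ incident with $v$. For real numbers $a \le b$, a fractional $[a,b]$-factor of $G$ is a function $h: E(G) \to [0,1]$ such that $a \le \sum_{e \in E_G(v)} h(e) \le b$ for every vertex $v \in V(G)$. *)

theory Defs
  imports Complex_Main
begin

type_synonym 'a ugraph = "'a set \<times> 'a set set"

definition verts :: "'a ugraph \<Rightarrow> 'a set" where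
  "verts G = fst G"

definition edges :: "'a ugraph \<Rightarrow> 'a set set" where
  "edges G = snd G"

text \<open>The graph without vertices is admitted.\<close>

definition finite_simple_graph :: "'a ugraph \<Rightarrow> bool" where
  "finite_simple_graph G \<longleftrightarrow>
     finite (verts G) \<and> (\<forall>e\<in>edges G. e \<subseteq> verts G \<and> card e = 2)"

definition incident_edges :: "'a ugraph \<Rightarrow> 'a \<Rightarrow> 'a set set" where
  "incident_edges G v = {e \<in> edges G. v \<in> e}"

definition delete_verts :: "'a ugraph \<Rightarrow> 'a set \<Rightarrow> 'a ugraph" where
  "delete_verts G S = (verts G - S, {e \<in> edges G. e \<inter> S = {}})"

definition num_isolated :: "'a ugraph \<Rightarrow> nat" where
  "num_isolated G = card {v \<in> verts G. incident_edges G v = {}}"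

text \<open>
  A function \<open>E(G) \<rightarrow> [0,1]\<close> is represented by a total function on vertex sets,
  of which only the values on the edges of \<open>G\<close> matter.
\<close>

definition fractional_factor ::
    "'a ugraph \<Rightarrow> real \<Rightarrow> real \<Rightarrow> ('a set \<Rightarrow> real) \<Rightarrow> bool" where
  "fractional_factor G a b h \<longleftrightarrow>
     (\<forall>e\<in>edges G. 0 \<le> h e \<and> h e \<le> 1) \<and>
     (\<forall>v\<in>verts G. a \<le> (\<Sum>e\<in>incident_edges G v. h e) \<and>
                    (\<Sum>e\<in>incident_edges G v. h e) \<le> b)"

end

theory Submission
  imports Defs
begin

text \<open>
  Sufficiency: put \<open>m = 2k + 1\<close> and \<open>x = 2h\<close>, so that edge weights lie in \<open>{0,1,2}\<close> and weighted
  degrees must lie between \<open>2\<close> and \<open>m\<close>. Among the weightings with all degrees at most \<open>m\<close>,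
  take one that maximises the sum of \<open>min 2 (deg v)\<close>, and suppose that \<open>deg v \<le> 1\<close> for some \<open>v\<close>.
  From \<open>v\<close> follow alternating walks, increasing arbitrary edges and decreasing edges of
  positive weight. Maximality forces every vertex \<open>u\<close> reached by an increased edge to have degree
  \<open>m\<close> and every vertex \<open>w\<close> reached by a decreased edge to have degree at most \<open>2\<close>. Since \<open>m \<ge> 3\<close>, the
  set \<open>S\<close> of the former and the set \<open>T\<close> of the latter (with \<open>v\<close>) are disjoint, \<open>T\<close> consists of isolated
  vertices of \<open>G - S\<close>, and all weight at \<open>S\<close> goes to \<open>T\<close>, whence \<open>m |S| < 2 |T|\<close>.
\<close>

section \<open>Double counting of incidences and necessity of the condition\<close>

lemma finite_edges:
  assumes "finite_simple_graph G"
  shows "finite (edges G)"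
  using assms unfolding finite_simple_graph_def
  by (meson PowI finite_Pow_iff finite_subset subsetI)

text \<open>Exchanging the sums counts each edge once per end in \<open>A\<close>. The semiring is
  general because both real factors and natural weights are summed.\<close>

lemma sum_incident_edges:
  fixes h :: "'a set \<Rightarrow> 'b::comm_semiring_1"
  assumes "finite_simple_graph G" "finite A"
  shows "(\<Sum>v\<in>A. \<Sum>e\<in>incident_edges G v. h e) = (\<Sum>e\<in>edges G. of_nat (card (e \<inter> A)) * h e)"
proof -
  have fin: "finite (edges G)" using assms(1) by (rule finite_edges)
  have "(\<Sum>v\<in>A. \<Sum>e\<in>incident_edges G v. h e) = (\<Sum>v\<in>A. \<Sum>e\<in>edges G. if v \<in> e then h e else 0)"
    unfolding incident_edges_def by (intro sum.cong refl sum.inter_filter fin)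
  also have "\<dots> = (\<Sum>e\<in>edges G. \<Sum>v\<in>A. if v \<in> e then h e else 0)"
    by (rule sum.swap)
  also have "\<dots> = (\<Sum>e\<in>edges G. of_nat (card (e \<inter> A)) * h e)"
  proof (rule sum.cong[OF refl])
    fix e
    have "(\<Sum>v\<in>A. if v \<in> e then h e else 0) = (\<Sum>v\<in>{v\<in>A. v \<in> e}. h e)"
      by (rule sum.inter_filter[OF assms(2), symmetric])
    also have "{v\<in>A. v \<in> e} = e \<inter> A" by blast
    finally show "(\<Sum>v\<in>A. if v \<in> e then h e else 0) = of_nat (card (e \<inter> A)) * h e" by simp
  qed
  finally show ?thesis .
qed

lemma isolated_delete_verts:
  "{v \<in> verts (delete_verts G S). incident_edges (delete_verts G S) v = {}} =
   {v \<in> verts G - S. \<forall>e\<in>edges G. v \<in> e \<longrightarrow> e \<inter> S \<noteq> {}}"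
  unfolding incident_edges_def delete_verts_def verts_def edges_def by auto

text \<open>One of the two ends lies in \<open>S\<close>, so at most one is left for
  \<open>I\<close>.\<close>

lemma card_edge_Int_le:
  assumes "card e = 2" "e \<inter> S \<noteq> {}" "I \<inter> S = {}"
  shows "card (e \<inter> I) \<le> card (e \<inter> S)"
proof -
  have "finite e" using assms(1) card.infinite by fastforce
  then have "card (e \<inter> I) + card (e \<inter> S) = card ((e \<inter> I) \<union> (e \<inter> S))"
    using assms(3) by (intro card_Un_disjoint[symmetric]) auto
  also have "\<dots> \<le> card e" using \<open>finite e\<close> by (intro card_mono) auto
  finally have "card (e \<inter> I) + card (e \<inter> S) \<le> 2" using assms(1) by simp
  moreover have "card (e \<inter> S) > 0" using assms(2) \<open>finite e\<close> by (simp add: card_gt_0_iff)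
  ultimately show ?thesis by linarith
qed

text \<open>All edges at a vertex isolated in \<open>G - S\<close> end in \<open>S\<close>, so the
  demand 1 of each such vertex is met out of the at most \<open>b * card S\<close> available at
  \<open>S\<close>.\<close>

lemma num_isolated_le_of_fractional_factor:
  assumes G: "finite_simple_graph G" and h: "fractional_factor G 1 b h" and S: "S \<subseteq> verts G"
  shows "real (num_isolated (delete_verts G S)) \<le> b * real (card S)"
proof -
  define I where "I = {v \<in> verts G - S. \<forall>e\<in>edges G. v \<in> e \<longrightarrow> e \<inter> S \<noteq> {}}"
  have finV: "finite (verts G)" using G by (simp add: finite_simple_graph_def)
  have finS: "finite S" and finI: "finite I"
    using finV S by (auto simp: I_def intro: finite_subset)
  have "real (card I) = (\<Sum>v\<in>I. 1)" by simp
  also have "\<dots> \<le> (\<Sum>v\<in>I. \<Sum>e\<in>incident_edges G v. h e)"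
    using h by (intro sum_mono) (auto simp: fractional_factor_def I_def)
  also have "\<dots> = (\<Sum>e\<in>edges G. real (card (e \<inter> I)) * h e)"
    by (rule sum_incident_edges[OF G finI])
  also have "\<dots> \<le> (\<Sum>e\<in>edges G. real (card (e \<inter> S)) * h e)"
  proof (intro sum_mono mult_right_mono)
    fix e assume e: "e \<in> edges G"
    show "0 \<le> h e" using h e by (simp add: fractional_factor_def)
    have "card (e \<inter> I) \<le> card (e \<inter> S)"
    proof (cases "e \<inter> I = {}")
      case False
      then have "e \<inter> S \<noteq> {}" using e by (auto simp: I_def)
      then show ?thesis using G e
        by (intro card_edge_Int_le) (auto simp: I_def finite_simple_graph_def)
    qed simp
    then show "real (card (e \<inter> I)) \<le> real (card (e \<inter> S))" by simp
  qed
  also have "\<dots> = (\<Sum>v\<in>S. \<Sum>e\<in>incident_edges G v. h e)"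
    by (rule sum_incident_edges[OF G finS, symmetric])
  also have "\<dots> \<le> (\<Sum>v\<in>S. b)"
    using h S by (intro sum_mono) (auto simp: fractional_factor_def)
  finally show ?thesis
    by (simp add: num_isolated_def isolated_delete_verts I_def mult.commute)
qed

section \<open>Integral edge weightings with bounded degrees\<close>

locale bounded_weighting =
  fixes G :: "'a ugraph" and m :: nat
  assumes graph: "finite_simple_graph G" and three_le: "3 \<le> m"
begin

definition deg :: "('a set \<Rightarrow> nat) \<Rightarrow> 'a \<Rightarrow> nat" where
  "deg x v = (\<Sum>e\<in>incident_edges G v. x e)"

definition feasible :: "('a set \<Rightarrow> nat) \<Rightarrow> bool" where
  "feasible x \<longleftrightarrow> (\<forall>e\<in>edges G. x e \<le> 2) \<and> (\<forall>v\<in>verts G. deg x v \<le> m)"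

text \<open>With the cap at the demand 2, a unit taken from a vertex of degree at least 3 costs
  nothing.\<close>

definition pot :: "('a set \<Rightarrow> nat) \<Rightarrow> nat" where
  "pot x = (\<Sum>v\<in>verts G. min 2 (deg x v))"

lemma finite_verts: "finite (verts G)"
  using graph by (simp add: finite_simple_graph_def)

lemma finite_incident: "finite (incident_edges G v)"
  using finite_edges[OF graph] by (simp add: incident_edges_def)

lemma edge_verts: "{u, v} \<in> edges G \<Longrightarrow> u \<in> verts G \<and> v \<in> verts G \<and> u \<noteq> v"
  using graph by (force simp: finite_simple_graph_def)

lemma weight_le_deg: "e \<in> edges G \<Longrightarrow> v \<in> e \<Longrightarrow> x e \<le> deg x v"
  unfolding deg_def using finite_incident by (intro member_le_sum) (auto simp: incident_edges_def)

lemma deg_incr: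
  assumes "e \<in> edges G"
  shows "deg (x(e := x e + 1)) v = deg x v + (if v \<in> e then 1 else 0)"
proof (cases "v \<in> e")
  case True
  then have e: "e \<in> incident_edges G v" using assms by (simp add: incident_edges_def)
  show ?thesis unfolding deg_def sum.remove[OF finite_incident e] using True
    by (auto intro!: sum.cong)
next
  case False
  then have "e \<notin> incident_edges G v" by (simp add: incident_edges_def)
  then show ?thesis unfolding deg_def using False by (auto intro!: sum.cong)
qed

lemma deg_decr:
  assumes "e \<in> edges G" "x e > 0"
  shows "deg (x(e := x e - 1)) v + (if v \<in> e then 1 else 0) = deg x v"
  using deg_incr[OF assms(1), of "x(e := x e - 1)" v] assms(2) by simp

text \<open>One round of an alternating walk: when \<open>v \<noteq> w\<close> and
  \<open>{u, w}\<close> has positive weight, \<open>u\<close> keeps its degree and one unit of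
  degree passes from \<open>w\<close> to \<open>v\<close>.\<close>

definition shift :: "('a set \<Rightarrow> nat) \<Rightarrow> 'a \<Rightarrow> 'a \<Rightarrow> 'a \<Rightarrow> 'a set \<Rightarrow> nat" where
  "shift x v u w = x({v, u} := x {v, u} + 1, {u, w} := x {u, w} - 1)"

text \<open>As \<open>v \<noteq> w\<close>, the two edges differ and the updates do not interfere.
  The additive form avoids truncated subtraction.\<close>

lemma deg_shift:
  assumes "{v, u} \<in> edges G" "{u, w} \<in> edges G" "x {u, w} > 0" "v \<noteq> w"
  shows "deg (shift x v u w) z + (if z = w then 1 else 0) = deg x z + (if z = v then 1 else 0)"
proof -
  define y where "y = x({v, u} := x {v, u} + 1)"
  have ne: "{v, u} \<noteq> {u, w}" using assms(4) by (auto simp: doubleton_eq_iff)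
  have yuw: "y {u, w} = x {u, w}" using ne by (auto simp: y_def)
  have "shift x v u w = y({u, w} := y {u, w} - 1)"
    unfolding yuw by (simp add: shift_def y_def)
  then have "deg (shift x v u w) z + (if z \<in> {u, w} then 1 else 0) = deg y z"
    using deg_decr[OF assms(2), of y z] yuw assms(3) by simp
  moreover have "deg y z = deg x z + (if z \<in> {v, u} then 1 else 0)"
    unfolding y_def by (rule deg_incr[OF assms(1)])
  ultimately show ?thesis
    using edge_verts[OF assms(1)] edge_verts[OF assms(2)] assms(4) by (auto split: if_splits)
qed

text \<open>Only \<open>v\<close> gains degree, reaching at most 2, and \<open>{v, u}\<close> has
  weight at most \<open>deg x v \<le> 1\<close>, hence room for one more unit.\<close>

lemma feasible_shift:
  assumes "feasible x" "{v, u} \<in> edges G" "{u, w} \<in> edges G" "x {u, w} > 0" "v \<noteq> w" "deg x v \<le> 1"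
  shows "feasible (shift x v u w)"
  unfolding feasible_def
proof (intro conjI ballI)
  fix e assume e: "e \<in> edges G"
  have "x {v, u} \<le> 1" using weight_le_deg[OF assms(2), of v x] assms(6) by simp
  then show "shift x v u w e \<le> 2"
    using assms(1) e by (fastforce simp: shift_def feasible_def)
next
  fix z assume z: "z \<in> verts G"
  show "deg (shift x v u w) z \<le> m"
  proof (cases "z = v")
    case True
    then show ?thesis using deg_shift[of v u w x z, OF assms(2-5)] assms(5,6) three_le by simp
  next
    case False
    then have "deg (shift x v u w) z \<le> deg x z"
      using deg_shift[of v u w x z, OF assms(2-5)] by (auto split: if_splits)
    then show ?thesis using assms(1) z by (fastforce simp: feasible_def)
  qed
qed

text \<open>The gain at \<open>v\<close> is below the cap and counts; the loss at \<open>w\<close>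
  counts only if \<open>w\<close> was not above the cap.\<close>

lemma pot_shift:
  assumes "{v, u} \<in> edges G" "{u, w} \<in> edges G" "x {u, w} > 0" "v \<noteq> w" "deg x v \<le> 1"
  shows "pot (shift x v u w) + (if deg x w \<le> 2 then 1 else 0) = pot x + 1"
proof -
  have vw: "v \<in> verts G" "w \<in> verts G" using edge_verts[OF assms(1)] edge_verts[OF assms(2)] by auto
  have "deg x w > 0" using weight_le_deg[OF assms(2), of w x] assms(3) by simp
  then have "min 2 (deg (shift x v u w) z) + (if z = w then if deg x w \<le> 2 then 1 else 0 else 0)
      = min 2 (deg x z) + (if z = v then 1 else 0)" for z
    using deg_shift[of v u w x z, OF assms(1-4)] assms(4,5) by (auto split: if_splits)
  then have "(\<Sum>z\<in>verts G. min 2 (deg (shift x v u w) z) + (if z = w then if deg x w \<le> 2 then 1 else 0 else 0))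
      = (\<Sum>z\<in>verts G. min 2 (deg x z) + (if z = v then 1 else 0))"
    by (intro sum.cong) auto
  then show ?thesis
    unfolding pot_def sum.distrib using vw finite_verts by (simp add: sum.delta)
qed

section \<open>Augmenting walks\<close>

text \<open>
  \<open>aug x n v\<close>: an alternating walk of at most \<open>n + 1\<close> rounds leads from \<open>v\<close> to a vertex that
  can absorb the change. The constraint \<open>x {v, u} < 2\<close> for increased edges may be omitted since
  the walk is only used from a vertex of degree at most \<open>1\<close>, and a shift creates the
  next such vertex.
\<close>

inductive aug :: "('a set \<Rightarrow> nat) \<Rightarrow> nat \<Rightarrow> 'a \<Rightarrow> bool" for x where
  incr: "{v, u} \<in> edges G \<Longrightarrow> deg x u < m \<Longrightarrow> aug x n v"
| decr: "{v, u} \<in> edges G \<Longrightarrow> {u, w} \<in> edges G \<Longrightarrow> x {u, w} > 0 \<Longrightarrow> deg x w \<ge> 3 \<Longrightarrow> aug x n v"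
| step: "{v, u} \<in> edges G \<Longrightarrow> {u, w} \<in> edges G \<Longrightarrow> x {u, w} > 0 \<Longrightarrow> aug x n w \<Longrightarrow> aug x (Suc n) v"

text \<open>A shift can harm a walk only at \<open>v\<close>, at \<open>w\<close> or on
  \<open>{u, w}\<close>. The degree of \<open>v\<close> stays at most 2, below \<open>m\<close>. A
  walk entering \<open>w\<close> by an increased edge can stop there, since \<open>w\<close> now has
  room. A walk decreasing the edge from \<open>u\<close> to \<open>w\<close> is excluded by
  \<open>dw\<close> in a final \<open>decr\<close> round and by \<open>no\<close> in a
  \<open>step\<close> round, as \<open>v\<close> would then have an equally short walk.\<close>

lemma aug_shift:
  assumes "aug x j z" "j \<le> n"
    and vu: "{v, u} \<in> edges G" and uw: "{u, w} \<in> edges G" and pos: "x {u, w} > 0" and "v \<noteq> w"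
    and dv: "deg x v \<le> 1" and dw: "deg x w \<le> 2" and no: "\<And>i. i \<le> n \<Longrightarrow> \<not> aug x i v"
  shows "aug (shift x v u w) j z"
  using assms(1,2)
proof (induction rule: aug.induct)
  case (incr z u' j)
  have "deg (shift x v u w) u' < m"
    using deg_shift[of v u w x u', OF vu uw pos \<open>v \<noteq> w\<close>] incr dv three_le by (auto split: if_splits)
  with incr show ?case by (blast intro: aug.incr)
next
  case (decr z u' w' j)
  show ?case
  proof (cases "u' = w")
    case True
    have "deg (shift x v u w) w < m"
      using deg_shift[of v u w x w, OF vu uw pos \<open>v \<noteq> w\<close>] \<open>v \<noteq> w\<close> dw three_le by auto
    with decr True show ?thesis by (blast intro: aug.incr)
  next
    case False
    have "w' \<noteq> w" using decr dw by auto
    then have "{u', w'} \<noteq> {u, w}" using False by (auto simp: doubleton_eq_iff)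
    then have "shift x v u w {u', w'} > 0" using decr by (simp add: shift_def)
    moreover have "deg (shift x v u w) w' \<ge> 3"
      using deg_shift[of v u w x w', OF vu uw pos \<open>v \<noteq> w\<close>] \<open>w' \<noteq> w\<close> decr by (auto split: if_splits)
    ultimately show ?thesis using decr by (blast intro: aug.decr)
  qed
next
  case (step z u' w' j)
  show ?case
  proof (cases "u' = w")
    case True
    have "deg (shift x v u w) w < m"
      using deg_shift[of v u w x w, OF vu uw pos \<open>v \<noteq> w\<close>] \<open>v \<noteq> w\<close> dw three_le by auto
    with step True show ?thesis by (blast intro: aug.incr)
  next
    case False
    have "\<not> (u' = u \<and> w' = w)"
    proof
      assume "u' = u \<and> w' = w"
      then have "aug x (Suc j) v" using step vu by (blast intro: aug.step)
      with no step.prems show False by blast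
    qed
    then have "{u', w'} \<noteq> {u, w}" using False by (auto simp: doubleton_eq_iff)
    then have "shift x v u w {u', w'} > 0" using step by (simp add: shift_def)
    moreover have "aug (shift x v u w) j w'" using step by simp
    ultimately show ?thesis using step by (blast intro: aug.step)
  qed
qed

lemma improve_incr:
  assumes "feasible x" "{v, u} \<in> edges G" "deg x v \<le> 1" "deg x u < m"
  shows "\<exists>y. feasible y \<and> pot y > pot x"
proof -
  define y where "y = x({v, u} := x {v, u} + 1)"
  have dy: "deg y z = deg x z + (if z \<in> {v, u} then 1 else 0)" for z
    unfolding y_def by (rule deg_incr[OF assms(2)])
  have "x {v, u} \<le> 1" using weight_le_deg[OF assms(2), of v x] assms(3) by simp
  then have "\<forall>e\<in>edges G. y e \<le> 2" using assms(1) by (auto simp: y_def feasible_def)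
  moreover have "\<forall>z\<in>verts G. deg y z \<le> m"
    using assms three_le by (auto simp: dy feasible_def)
  ultimately have "feasible y" by (simp add: feasible_def)
  moreover have "pot x < pot y"
    unfolding pot_def using finite_verts
  proof (rule sum_strict_mono_ex1)
    show "\<forall>z\<in>verts G. min 2 (deg x z) \<le> min 2 (deg y z)" by (auto simp: dy)
    show "\<exists>z\<in>verts G. min 2 (deg x z) < min 2 (deg y z)"
      using assms(3) edge_verts[OF assms(2)] by (intro bexI[of _ v]) (auto simp: dy)
  qed
  ultimately show ?thesis by blast
qed

text \<open>Induction on the length of the walk: a final round raises \<open>pot\<close> at once;
  otherwise a shift raises it or hands the deficiency on to \<open>w\<close>, whose remaining walk
  is shorter.\<close>

lemma aug_improve:
  assumes "feasible x" "aug x n v" "deg x v \<le> 1"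
  shows "\<exists>y. feasible y \<and> pot y > pot x"
  using assms
proof (induction n arbitrary: x v rule: less_induct)
  case (less n)
  show ?case
  proof (cases "\<exists>i<n. aug x i v")
    \<comment> \<open>Passing to a smaller index leaves only the case of minimal \<open>n\<close>,
      which \<open>aug_shift\<close> requires.\<close>
    case True
    then show ?thesis using less by blast
  next
    case False
    from \<open>aug x n v\<close> show ?thesis
    proof cases
      case (incr u)
      then show ?thesis using less improve_incr by blast
    next
      case (decr u w)
      then have "v \<noteq> w" using less.prems by auto
      then show ?thesis
        using feasible_shift[of x v u w] pot_shift[of v u w x] decr less.prems
        by (intro exI[of _ "shift x v u w"]) auto
    next
      case (step u w j)
      \<comment> \<open>With \<open>w = v\<close> the rest of the walk would be a shorter one from
        \<open>v\<close>.\<close>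
      then have "v \<noteq> w" using False by auto
      show ?thesis
      proof (cases "deg x w \<le> 2")
        case dw: True
        \<comment> \<open>Hence \<open>w\<close> now has degree at most 1 and takes over the role of
          \<open>v\<close>.\<close>
        have *: "deg (shift x v u w) w + 1 = deg x w"
          using deg_shift[of v u w x w] step \<open>v \<noteq> w\<close> by simp
        have "aug (shift x v u w) j w"
          using False step less.prems \<open>v \<noteq> w\<close> dw by (intro aug_shift[where n = j]) auto
        moreover have "feasible (shift x v u w)"
          using feasible_shift step less.prems \<open>v \<noteq> w\<close> by blast
        moreover have "pot (shift x v u w) = pot x"
          using pot_shift[of v u w x] step less.prems \<open>v \<noteq> w\<close> dw by simp
        ultimately show ?thesis
          using less.IH[of j "shift x v u w" w] step * dw by auto
      next
        case False
        then show ?thesis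
          using feasible_shift[of x v u w] pot_shift[of v u w x] step less.prems \<open>v \<noteq> w\<close>
          by (intro exI[of _ "shift x v u w"]) auto
      qed
    qed
  qed
qed

section \<open>Reached vertices and the barrier\<close>

inductive_set alt_reach :: "('a set \<Rightarrow> nat) \<Rightarrow> 'a \<Rightarrow> 'a set" for x v where
  base: "v \<in> alt_reach x v"
| step: "z \<in> alt_reach x v \<Longrightarrow> {z, u} \<in> edges G \<Longrightarrow> {u, w} \<in> edges G \<Longrightarrow> x {u, w} > 0
    \<Longrightarrow> w \<in> alt_reach x v"

text \<open>A walk from a reached vertex extends back to \<open>v\<close> by
  \<open>aug.step\<close>. Each round raises the index, so all \<open>n\<close> are treated
  together.\<close>

lemma no_aug_alt_reach:
  assumes "z \<in> alt_reach x v" "\<And>n. \<not> aug x n v"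
  shows "\<not> aug x n z"
  using assms(1)
proof (induction arbitrary: n rule: alt_reach.induct)
  case base
  show ?case by (rule assms(2))
next
  case (step z u w)
  then show ?case by (blast intro: aug.step)
qed

text \<open>A reached vertex of degree at least 3 would let its predecessor use
  \<open>aug.decr\<close>.\<close>

lemma deg_alt_reach:
  assumes "z \<in> alt_reach x v" "\<And>n. \<not> aug x n v" "deg x v \<le> 1"
  shows "deg x z \<le> 2"
  using assms(1)
proof cases
  case base
  then show ?thesis using assms(3) by simp
next
  case (step z' u)
  then have "\<not> aug x 0 z'" using no_aug_alt_reach assms(2) by blast
  then show ?thesis using step aug.decr[of z' u z x 0] by force
qed

lemma deficient_barrier:
  assumes x: "feasible x" and v: "v \<in> verts G" "deg x v \<le> 1" and no: "\<And>n. \<not> aug x n v"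
  shows "\<exists>S\<subseteq>verts G. m * card S < 2 * num_isolated (delete_verts G S)"
proof -
  define T where "T = alt_reach x v"
  define S where "S = {u. \<exists>z\<in>T. {z, u} \<in> edges G}"
  have vT: "v \<in> T" by (simp add: T_def alt_reach.base)
  have TV: "T \<subseteq> verts G"
  proof
    fix z assume "z \<in> T"
    then show "z \<in> verts G" unfolding T_def by cases (use v edge_verts in auto)
  qed
  have SV: "S \<subseteq> verts G" using edge_verts by (auto simp: S_def)
  have finT: "finite T" and finS: "finite S" using TV SV finite_verts finite_subset by blast+
  have degT: "deg x z \<le> 2" if "z \<in> T" for z using that deg_alt_reach no v by (simp add: T_def)
  have degS: "deg x u = m" if "u \<in> S" for u
  proof -
    from that obtain z where z: "z \<in> T" "{z, u} \<in> edges G" by (auto simp: S_def)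
    then have "\<not> aug x 0 z" using no_aug_alt_reach no by (simp add: T_def)
    then have "deg x u \<ge> m" using z aug.incr by (meson not_less)
    then show ?thesis using x that SV by (fastforce simp: feasible_def)
  qed
  have disj: "S \<inter> T = {}" using degT degS three_le by fastforce
  have card2: "\<exists>a b. e = {a, b} \<and> a \<noteq> b" if "e \<in> edges G" for e
    using graph that by (auto simp: finite_simple_graph_def card_2_iff)
  have meetT: "e \<inter> S \<noteq> {}" if e: "e \<in> edges G" "e \<inter> T \<noteq> {}" for e
  proof -
    from card2[OF e(1)] e(2) obtain a b where "e = {a, b}" "a \<in> T"
      by (metis disjoint_iff insert_commute insert_iff singletonD)
    then show ?thesis using e(1) by (auto simp: S_def)
  qed
  have meetS: "e \<inter> T \<noteq> {}" if e: "e \<in> edges G" "e \<inter> S \<noteq> {}" "x e > 0" for e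
  proof -
    from card2[OF e(1)] e(2) obtain a b where ab: "e = {a, b}" "a \<in> S"
      by (metis disjoint_iff insert_commute insert_iff singletonD)
    then obtain z where "z \<in> T" "{z, a} \<in> edges G" by (auto simp: S_def)
    then have "b \<in> T" using e ab unfolding T_def by (blast intro: alt_reach.step)
    then show ?thesis using ab by auto
  qed
  \<comment> \<open>The degree sums over \<open>S\<close> and \<open>T\<close> agree edge by edge:
    an edge of positive weight meeting either set has exactly one end in each.\<close>
  have "(\<Sum>u\<in>S. deg x u) = (\<Sum>e\<in>edges G. card (e \<inter> S) * x e)"
    unfolding deg_def using sum_incident_edges[OF graph finS, of x] by simp
  also have "\<dots> = (\<Sum>e\<in>edges G. card (e \<inter> T) * x e)"
  proof (rule sum.cong[OF refl])
    fix e assume e: "e \<in> edges G"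
    have two: "card e = 2" using graph e by (simp add: finite_simple_graph_def)
    consider "x e = 0" | "e \<inter> S = {}" "e \<inter> T = {}" | "e \<inter> S \<noteq> {}" "e \<inter> T \<noteq> {}"
      using meetS[OF e] meetT[OF e] by blast
    then show "card (e \<inter> S) * x e = card (e \<inter> T) * x e"
    proof cases
      case 3
      then have "card (e \<inter> S) = card (e \<inter> T)"
        using card_edge_Int_le[OF two] disj by (metis Int_commute le_antisym)
      then show ?thesis by simp
    qed simp_all
  qed
  also have "\<dots> = (\<Sum>z\<in>T. deg x z)"
    unfolding deg_def using sum_incident_edges[OF graph finT, of x] by simp
  \<comment> \<open>Strict because \<open>v\<close> itself has degree at most 1.\<close>
  also have "\<dots> < (\<Sum>z\<in>T. 2)"
    using finT degT vT v(2) by (intro sum_strict_mono_ex1) (auto intro!: bexI[of _ v])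
  finally have "m * card S < 2 * card T" using degS by (simp add: mult.commute)
  moreover have "card T \<le> num_isolated (delete_verts G S)"
    unfolding num_isolated_def isolated_delete_verts
    using TV disj meetT finite_verts by (intro card_mono) auto
  ultimately show ?thesis using SV by (intro exI[of _ S]) auto
qed

text \<open>In a feasible weighting of greatest \<open>pot\<close>, a vertex of degree at most 1
  would give either an improvement or a set \<open>S\<close> violating the assumption.\<close>

lemma exists_weighting:
  assumes "\<And>S. S \<subseteq> verts G \<Longrightarrow> 2 * num_isolated (delete_verts G S) \<le> m * card S"
  shows "\<exists>x. (\<forall>e\<in>edges G. x e \<le> 2) \<and> (\<forall>v\<in>verts G. 2 \<le> deg x v \<and> deg x v \<le> m)"
proof -
  have bound: "\<forall>x. feasible x \<longrightarrow> pot x < Suc (2 * card (verts G))"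
  proof (intro allI impI)
    fix x
    have "pot x \<le> (\<Sum>v\<in>verts G. 2)" unfolding pot_def by (intro sum_mono) simp
    then show "pot x < Suc (2 * card (verts G))" by simp
  qed
  have "feasible (\<lambda>_. 0)" by (simp add: feasible_def deg_def)
  from ex_has_greatest_nat[of feasible, OF this bound]
  obtain x where x: "feasible x" and max: "\<And>y. feasible y \<Longrightarrow> pot y \<le> pot x" by blast
  have "2 \<le> deg x v" if v: "v \<in> verts G" for v
  proof (rule ccontr)
    assume "\<not> 2 \<le> deg x v"
    then have dv: "deg x v \<le> 1" by simp
    have "\<not> aug x n v" for n using aug_improve[OF x _ dv] max by (meson not_less)
    then show False using deficient_barrier[OF x v dv] assms by (meson not_less)
  qed
  then show ?thesis using x by (auto simp: feasible_def)
qed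

end

theorem theorem9:
  fixes G :: "'a ugraph" and k :: nat
  assumes "finite_simple_graph G" and "k \<ge> 1"
  shows "(\<exists>h. fractional_factor G 1 (real k + 1/2) h \<and> (\<forall>e\<in>edges G. h e \<in> {0, 1/2, 1}))
    \<longleftrightarrow> (\<forall>S\<subseteq>verts G. real (num_isolated (delete_verts G S)) \<le> (real k + 1/2) * real (card S))"
proof
  assume "\<exists>h. fractional_factor G 1 (real k + 1/2) h \<and> (\<forall>e\<in>edges G. h e \<in> {0, 1/2, 1})"
  then show "\<forall>S\<subseteq>verts G. real (num_isolated (delete_verts G S)) \<le> (real k + 1/2) * real (card S)"
    using num_isolated_le_of_fractional_factor[OF assms(1)] by blast
next
  assume iso: "\<forall>S\<subseteq>verts G. real (num_isolated (delete_verts G S)) \<le> (real k + 1/2) * real (card S)"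
  \<comment> \<open>Doubling clears the halves: the bound \<open>k + 1/2\<close> becomes
    \<open>2 * k + 1\<close>, which is at least 3 by \<open>k \<ge> 1\<close>.\<close>
  interpret bounded_weighting G "2 * k + 1"
    using assms by unfold_locales auto
  have "2 * num_isolated (delete_verts G S) \<le> (2 * k + 1) * card S" if "S \<subseteq> verts G" for S
  proof -
    have "real (num_isolated (delete_verts G S)) \<le> (real k + 1/2) * real (card S)"
      using iso that by blast
    then have "real (2 * num_isolated (delete_verts G S)) \<le> real ((2 * k + 1) * card S)"
      by (simp add: algebra_simps)
    then show ?thesis by (simp only: of_nat_le_iff)
  qed
  then obtain x where x: "\<And>e. e \<in> edges G \<Longrightarrow> x e \<le> 2"
    and d: "\<And>v. v \<in> verts G \<Longrightarrow> 2 \<le> deg x v \<and> deg x v \<le> 2 * k + 1"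
    using exists_weighting by blast
  \<comment> \<open>Halving turns the weights 0, 1, 2 into 0, 1/2, 1 and the degree bounds 2 and
    \<open>2 * k + 1\<close> into 1 and \<open>k + 1/2\<close>.\<close>
  define h where "h e = real (x e) / 2" for e
  have sum_h: "(\<Sum>e\<in>incident_edges G v. h e) = real (deg x v) / 2" for v
    by (simp add: h_def deg_def sum_divide_distrib)
  have "fractional_factor G 1 (real k + 1/2) h"
    unfolding fractional_factor_def sum_h
  proof (intro conjI ballI)
    fix e assume "e \<in> edges G"
    then show "0 \<le> h e" "h e \<le> 1" using x[of e] by (simp_all add: h_def)
  next
    fix v assume "v \<in> verts G"
    then show "1 \<le> real (deg x v) / 2" "real (deg x v) / 2 \<le> real k + 1/2"
      using d[of v] by linarith+
  qed
  moreover have "h e \<in> {0, 1/2, 1}" if "e \<in> edges G" for e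
  proof -
    have "x e \<in> {0, 1, 2}" using x[OF that] by auto
    then show ?thesis by (auto simp: h_def)
  qed
  ultimately show "\<exists>h. fractional_factor G 1 (real k + 1/2) h \<and> (\<forall>e\<in>edges G. h e \<in> {0, 1/2, 1})"
    by blast
qed

end
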